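(* Let $n$ be even, let $M^\star=u^\star(u^\star)^\top\in\mathbb{R}^{n\times n}$ with $u^\star=(1,1,\dots,1)^\top$ (so $M^\star$ is the all-ones matrix), let $2^{-1/4}<\beta\le\frac{9}{10}$ and $\gamma=\frac{1+\beta^2}{1-\beta^2}$ (so $\gamma<10$). Let $$u=\begin{pmatrix}\beta\mathbf 1\\ -\beta\mathbf 1\end{pmatrix}\in\mathbb{R}^n,\qquad W=\begin{pmatrix}\gamma J & J \\ {J} & \gamma J\end{pmatrix}\in\mathbb{R}^{n\times n},$$ where $\mathbf 1\in\mathbb{R}^{n/2}$ is the all-ones vector and $J$ is the $(n/2)\times(n/2)$ all-ones matrix. Then $u$ is a local minimum of the function $f:\mathbb{R}^n\to\mathbb{R}$, $$f(x)=\tfrac12\|xx^\top-M^\star\|_W^2+\lambda\sum_{i=1}^n(|x_i|-\alpha)_+^4 ,$$ where $\alpha^2=\frac{C\mu r\sigma_1^\star}{n}$ and $\lambda=\frac{C^2n}{\mu r\kappa^\star}$ for a large enough universal constant $C$.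
   Context: $\|A\|_W^2=\sum_{i,j}W_{i,j}A_{i,j}^2$ and $x_+=\max\{x,0\}$. Here $r$, $\sigma_1^\star$, $\kappa^\star$, $\mu$ are the rank, largest singular value, condition number (ratio of largest to smallest nonzero singular value) and incoherence parameter of $M^\star$ (for $M^\star$ with SVD $XDX^\top$, $\|X_i\|\le\sqrt{\mu r/n}$ for all rows $X_i$); for this $M^\star$ one has $r=1$, $\sigma_1^\star=n$, $\kappa^\star=1$, $\mu=1$. *)

theory Defs
  imports
    Complex_Main
    "Jordan_Normal_Form.Matrix"
    "Jordan_Normal_Form.Char_Poly"
    "Jordan_Normal_Form.DL_Rank"
begin

text \<open>
  The constant of the result is uniform in the dimension, so the dimension has to be
  quantified inside the formula; vectors and matrices are therefore those with a carrier
  indexed by natural numbers, and the Euclidean topology, which these types do not come with,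
  is spelled out through the norm.
\<close>

definition euclidean_norm :: "real vec \<Rightarrow> real" where
  "euclidean_norm v = sqrt (v \<bullet> v)"

definition is_local_min :: "nat \<Rightarrow> (real vec \<Rightarrow> real) \<Rightarrow> real vec \<Rightarrow> bool" where
  "is_local_min n f u \<longleftrightarrow>
     u \<in> carrier_vec n \<and>
     (\<exists>\<epsilon>>0. \<forall>x\<in>carrier_vec n. euclidean_norm (x - u) < \<epsilon> \<longrightarrow> f u \<le> f x)"

definition outer_self :: "real vec \<Rightarrow> real mat" where
  "outer_self x = mat (dim_vec x) (dim_vec x) (\<lambda>(i, j). x $ i * x $ j)"

definition const_vec :: "nat \<Rightarrow> real \<Rightarrow> real vec" where
  "const_vec n c = vec n (\<lambda>_. c)"

definition all_ones_mat :: "nat \<Rightarrow> real mat" where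
  "all_ones_mat n = mat n n (\<lambda>_. 1)"

definition weighted_norm_sq :: "real mat \<Rightarrow> real mat \<Rightarrow> real" where
  "weighted_norm_sq W A = (\<Sum>i<dim_row A. \<Sum>j<dim_col A. W $$ (i, j) * (A $$ (i, j))\<^sup>2)"

definition objective ::
  "real mat \<Rightarrow> real mat \<Rightarrow> real \<Rightarrow> real \<Rightarrow> real vec \<Rightarrow> real" where
  "objective W M reg \<alpha> x =
     1/2 * weighted_norm_sq W (outer_self x - M) +
     reg * (\<Sum>i<dim_vec x. (max (\<bar>x $ i\<bar> - \<alpha>) 0) ^ 4)"

definition mat_rank :: "real mat \<Rightarrow> nat" where
  "mat_rank A = vec_space.rank (dim_row A) A"

definition singular_values :: "real mat \<Rightarrow> real set" where
  "singular_values A = {s. 0 \<le> s \<and> eigenvalue (transpose_mat A * A) (s\<^sup>2)}"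

definition max_singular_value :: "real mat \<Rightarrow> real" where
  "max_singular_value A = Max (singular_values A)"

definition condition_number :: "real mat \<Rightarrow> real" where
  "condition_number A = max_singular_value A / Min (singular_values A - {0})"

text \<open>
  The compact singular value decomposition of a symmetric positive semidefinite matrix, whose
  left and right singular vectors coincide.  It is unique up to an orthogonal change of the
  columns of \<open>X\<close>, which does not affect the norms of the rows of \<open>X\<close>, so that the existential
  quantifier in the definition of the incoherence parameter is harmless.
\<close>

definition is_symmetric_svd :: "real mat \<Rightarrow> real mat \<Rightarrow> real mat \<Rightarrow> bool" where
  "is_symmetric_svd M X D \<longleftrightarrow>
     (let n = dim_row M; r = mat_rank M in
        M \<in> carrier_mat n n \<and> X \<in> carrier_mat n r \<and> D \<in> carrier_mat r r \<and>
        transpose_mat X * X = 1\<^sub>m r \<and>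
        diagonal_mat D \<and> (\<forall>i<r. 0 < D $$ (i, i)) \<and>
        M = X * D * transpose_mat X)"

text \<open>The smallest \<open>\<mu>\<close> for which the row bound holds.\<close>

definition incoherence :: "real mat \<Rightarrow> real" where
  "incoherence M = Inf {\<mu>::real. 0 \<le> \<mu> \<and> (\<exists>X D. is_symmetric_svd M X D \<and>
     (\<forall>i<dim_row M. euclidean_norm (row X i) \<le> sqrt (\<mu> * real (mat_rank M) / real (dim_row M))))}"

end

theory Submission
  imports Defs
begin

text \<open>
  At $u$ the regularizer vanishes, since $\alpha = \sqrt C \ge 1 > \beta$, so only the weighted
  norm matters. It depends on $x$ only through the sums and the sums of squares of the two halves
  of $x$, and increases with the latter; by Cauchy-Schwarz one may therefore replace each half by
  its mean. This leaves a quartic in the two means $s, t$ which, multiplied by $1 - \beta^2$,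
  exceeds its value at $(\beta, -\beta)$ by
  $(s^2 + t^2 - 2\beta^2)^2 + (s + t)^2(\beta^2(s - t)^2 - 2(1 - \beta^2))$.
  This is nonnegative whenever $s \ge 1/\sqrt 2$, $t \le -1/\sqrt 2$ and $\beta^2 \ge 1/2$.
\<close>

section \<open>Sums over index ranges and their second moments\<close>

lemma sum_lessThan_plus:
  fixes f :: "nat \<Rightarrow> 'a::comm_monoid_add"
  shows "(\<Sum>i<m + k. f i) = (\<Sum>i<m. f i) + (\<Sum>i<k. f (m + i))"
  by (induction k) (simp_all add: add.assoc)

text \<open>Applied to each block of the weighted norm, this shows that a block sees the two halves
  of \<open>x\<close> only through their sums and sums of squares.\<close>

lemma sum_sum_product_minus_one_squared:
  fixes f g :: "nat \<Rightarrow> real"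
  shows "(\<Sum>i<m. \<Sum>j<k. (f i * g j - 1)\<^sup>2) =
    (\<Sum>i<m. (f i)\<^sup>2) * (\<Sum>j<k. (g j)\<^sup>2) - 2 * (\<Sum>i<m. f i) * (\<Sum>j<k. g j) + real m * real k"
proof -
  have "(\<Sum>i<m. \<Sum>j<k. (f i * g j - 1)\<^sup>2) =
      (\<Sum>i<m. \<Sum>j<k. (f i)\<^sup>2 * (g j)\<^sup>2 - 2 * (f i * g j) + 1)"
    by (intro sum.cong refl) (simp add: power2_eq_square algebra_simps)
  also have "\<dots> = (\<Sum>i<m. (f i)\<^sup>2) * (\<Sum>j<k. (g j)\<^sup>2) - 2 * ((\<Sum>i<m. f i) * (\<Sum>j<k. g j)) + real m * real k"
    by (simp add: sum.distrib sum_subtractf sum_distrib_left[symmetric] sum_product)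
  finally show ?thesis by simp
qed

text \<open>The squared deviations of \<open>f\<close> from \<open>s\<close> have a nonnegative sum;
  expanding it gives the bound. This is the Cauchy-Schwarz step that replaces a half by its
  mean.\<close>

lemma sum_squares_ge_mean:
  fixes f :: "nat \<Rightarrow> real"
  assumes "(\<Sum>i<m. f i) = real m * s"
  shows "real m * s\<^sup>2 \<le> (\<Sum>i<m. (f i)\<^sup>2)"
proof -
  have "0 \<le> (\<Sum>i<m. (f i - s)\<^sup>2)" by (simp add: sum_nonneg)
  also have "\<dots> = (\<Sum>i<m. (f i)\<^sup>2 - 2 * s * f i + s\<^sup>2)"
    by (intro sum.cong refl) (simp add: power2_eq_square algebra_simps)
  also have "\<dots> = (\<Sum>i<m. (f i)\<^sup>2) - 2 * s * (\<Sum>i<m. f i) + real m * s\<^sup>2"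
    by (simp add: sum.distrib sum_subtractf sum_distrib_left[symmetric])
  finally show ?thesis using assms by (simp add: power2_eq_square algebra_simps)
qed

section \<open>The quartic inequality in the two means\<close>

lemma two_block_quartic_min:
  fixes \<beta> \<gamma> s t :: real
  assumes \<gamma>: "\<gamma> = (1 + \<beta>\<^sup>2) / (1 - \<beta>\<^sup>2)" and \<beta>: "1/2 < \<beta>\<^sup>2" "\<beta>\<^sup>2 < 1"
    and st: "2 \<le> (s - t)\<^sup>2"
  shows "2 * \<gamma> * (\<beta>\<^sup>2 - 1)\<^sup>2 + 2 * (\<beta>\<^sup>2 + 1)\<^sup>2 \<le>
    \<gamma> * (s\<^sup>2 - 1)\<^sup>2 + \<gamma> * (t\<^sup>2 - 1)\<^sup>2 + 2 * (s * t - 1)\<^sup>2"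
proof -
  define d where "d = 1 - \<beta>\<^sup>2"
  have d: "0 < d" "\<beta>\<^sup>2 = 1 - d" using \<beta> by (simp_all add: d_def)
  \<comment> \<open>Multiplying by the positive \<open>d\<close> clears the denominator of \<gamma>,
    so that what remains is a polynomial identity in s, t and d.\<close>
  have g: "d * \<gamma> = 2 - d" using d by (simp add: \<gamma>)
  \<comment> \<open>Since \<open>\<beta>\<^sup>2\<close> exceeds 1/2, twice it exceeds 1, whereas
    \<open>2 * d\<close> is below 1.\<close>
  have "\<beta>\<^sup>2 * 2 \<le> \<beta>\<^sup>2 * (s - t)\<^sup>2" using st by (intro mult_left_mono) auto
  hence "0 \<le> \<beta>\<^sup>2 * (s - t)\<^sup>2 - 2 * d" using \<beta> by (simp add: d_def)
  hence "0 \<le> (s\<^sup>2 + t\<^sup>2 - 2 * \<beta>\<^sup>2)\<^sup>2 + (s + t)\<^sup>2 * (\<beta>\<^sup>2 * (s - t)\<^sup>2 - 2 * d)"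
    by (intro add_nonneg_nonneg mult_nonneg_nonneg) auto
  also have "\<dots> = (d * \<gamma>) * ((s\<^sup>2 - 1)\<^sup>2 + (t\<^sup>2 - 1)\<^sup>2 - 2 * (\<beta>\<^sup>2 - 1)\<^sup>2)
      + d * (2 * (s * t - 1)\<^sup>2 - 2 * (\<beta>\<^sup>2 + 1)\<^sup>2)"
    unfolding g d(2) by (simp add: power2_eq_square algebra_simps)
  also have "\<dots> = d * ((\<gamma> * (s\<^sup>2 - 1)\<^sup>2 + \<gamma> * (t\<^sup>2 - 1)\<^sup>2 + 2 * (s * t - 1)\<^sup>2)
      - (2 * \<gamma> * (\<beta>\<^sup>2 - 1)\<^sup>2 + 2 * (\<beta>\<^sup>2 + 1)\<^sup>2))"
    by (simp add: algebra_simps)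
  finally show ?thesis using d(1) by (simp add: zero_le_mult_iff)
qed

section \<open>Block form of the weighted distance, and coordinates versus norm\<close>

lemma weighted_norm_sq_two_blocks:
  fixes x :: "real vec" and \<gamma> :: real
  assumes x: "x \<in> carrier_vec (m + m)"
  defines "W \<equiv> four_block_mat (\<gamma> \<cdot>\<^sub>m all_ones_mat m) (all_ones_mat m) (all_ones_mat m) (\<gamma> \<cdot>\<^sub>m all_ones_mat m)"
  shows "weighted_norm_sq W (outer_self x - outer_self (const_vec (m + m) 1)) =
    \<gamma> * (\<Sum>i<m. \<Sum>j<m. (x $ i * x $ j - 1)\<^sup>2)
    + \<gamma> * (\<Sum>i<m. \<Sum>j<m. (x $ (m + i) * x $ (m + j) - 1)\<^sup>2)
    + 2 * (\<Sum>i<m. \<Sum>j<m. (x $ i * x $ (m + j) - 1)\<^sup>2)"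
proof -
  have "weighted_norm_sq W (outer_self x - outer_self (const_vec (m + m) 1)) =
      (\<Sum>i<m + m. \<Sum>j<m + m. (if (i < m) = (j < m) then \<gamma> else 1) * (x $ i * x $ j - 1)\<^sup>2)"
    using x unfolding weighted_norm_sq_def
    by (auto simp: outer_self_def const_vec_def W_def all_ones_mat_def intro!: sum.cong)
  also have "\<dots> = \<gamma> * (\<Sum>i<m. \<Sum>j<m. (x $ i * x $ j - 1)\<^sup>2)
      + \<gamma> * (\<Sum>i<m. \<Sum>j<m. (x $ (m + i) * x $ (m + j) - 1)\<^sup>2)
      + (\<Sum>i<m. \<Sum>j<m. (x $ i * x $ (m + j) - 1)\<^sup>2)
      + (\<Sum>i<m. \<Sum>j<m. (x $ (m + i) * x $ j - 1)\<^sup>2)"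
    by (simp add: sum_lessThan_plus sum.distrib sum_distrib_left)
  \<comment> \<open>The two off-diagonal blocks are transposes of each other, which accounts for the
    factor 2.\<close>
  also have "(\<Sum>i<m. \<Sum>j<m. (x $ (m + i) * x $ j - 1)\<^sup>2) = (\<Sum>i<m. \<Sum>j<m. (x $ i * x $ (m + j) - 1)\<^sup>2)"
    by (subst sum.swap) (simp add: mult.commute)
  finally show ?thesis by simp
qed

text \<open>Turns Euclidean closeness to \<open>u\<close> into bounds on every coordinate.\<close>

lemma abs_index_le_euclidean_norm:
  assumes "i < dim_vec v"
  shows "\<bar>v $ i\<bar> \<le> euclidean_norm v"
proof -
  have "(v $ i)\<^sup>2 \<le> (\<Sum>j\<in>{0..<dim_vec v}. (v $ j)\<^sup>2)"
    using assms by (intro member_le_sum) auto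
  thus ?thesis
    by (simp add: euclidean_norm_def scalar_prod_def power2_eq_square real_le_rsqrt)
qed

section \<open>Rank, singular values and incoherence of the all-ones matrix\<close>

lemma const_vec_index [simp]: "i < n \<Longrightarrow> const_vec n c $ i = c"
  by (simp add: const_vec_def)

lemma const_vec_dim [simp]: "dim_vec (const_vec n c) = n"
  by (simp add: const_vec_def)

lemma const_vec_carrier [simp]: "const_vec n c \<in> carrier_vec n"
  by (simp add: const_vec_def)

lemma outer_self_ones_index [simp]:
  "i < n \<Longrightarrow> j < n \<Longrightarrow> outer_self (const_vec n 1) $$ (i, j) = 1"
  by (simp add: outer_self_def)

lemma outer_self_ones_carrier [simp]: "outer_self (const_vec n 1) \<in> carrier_mat n n"
  by (simp add: outer_self_def)

lemma outer_self_ones_dim [simp]: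
  "dim_row (outer_self (const_vec n 1)) = n" "dim_col (outer_self (const_vec n 1)) = n"
  by (simp_all add: outer_self_def)

lemma (in vec_space) lin_indpt_singleton:
  assumes "v \<in> carrier_vec n" "v \<noteq> 0\<^sub>v n"
  shows "lin_indpt {v}"
proof
  assume "lin_dep {v}"
  then obtain A a w where A: "finite A" "A \<subseteq> {v}" "lincomb a A = 0\<^sub>v n" "w \<in> A" "a w \<noteq> 0"
    unfolding lin_dep_def by auto
  hence "A = {v}" "w = v" by auto
  with A assms have "a v \<cdot>\<^sub>v v = 0\<^sub>v n" "a v \<noteq> 0"
    by (simp_all add: lincomb_def)
  moreover obtain i where "i < n" "v $ i \<noteq> 0"
    using assms by (metis carrier_vecD eq_vecI index_zero_vec)
  ultimately show False
    using assms(1) by (metis carrier_vecD index_smult_vec(1) index_zero_vec(1) mult_eq_0_iff)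
qed

text \<open>Each entry is a row factor times a column factor, which bounds the rank above by 1; a
  single nonzero column gives the matching lower bound.\<close>

lemma mat_rank_ones:
  assumes "0 < n"
  shows "mat_rank (outer_self (const_vec n 1)) = 1"
proof -
  interpret vec_space "TYPE(real)" n .
  let ?M = "outer_self (const_vec n 1)"
  have "rank ?M \<le> 1"
    by (rule rank_le_1_product_entries[of _ n "\<lambda>_. 1" "\<lambda>_. 1"]) auto
  moreover have "card {col ?M 0} \<le> rank ?M"
  proof (rule rank_ge_card_indpt)
    show "?M \<in> carrier_mat n n" by simp
    show "{col ?M 0} \<subseteq> set (cols ?M)" using assms by (auto simp: cols_def)
    have "col ?M 0 $ 0 \<noteq> 0\<^sub>v n $ 0" using assms by simp
    hence "col ?M 0 \<noteq> 0\<^sub>v n" by metis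
    thus "lin_indpt {col ?M 0}" using assms by (intro lin_indpt_singleton) auto
  qed
  ultimately show ?thesis by (simp add: mat_rank_def)
qed

lemma gram_ones_mult_vec:
  assumes "v \<in> carrier_vec n"
  shows "(transpose_mat (outer_self (const_vec n 1)) * outer_self (const_vec n 1)) *\<^sub>v v
    = const_vec n (real n * (\<Sum>i<n. v $ i))"
  using assms
  by (intro eq_vecI)
     (auto simp: scalar_prod_def sum_distrib_left lessThan_atLeast0 intro!: sum.cong)

text \<open>The second claim is only an inclusion because 0 is a singular value exactly when
  \<open>n\<close> exceeds 1. In either case the largest and the smallest nonzero singular value are
  both \<open>n\<close>.\<close>

lemma singular_values_ones:
  assumes "0 < n"
  shows "real n \<in> singular_values (outer_self (const_vec n 1))"
    and "singular_values (outer_self (const_vec n 1)) \<subseteq> {0, real n}"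
proof -
  let ?M = "outer_self (const_vec n 1)"
  let ?G = "transpose_mat ?M * ?M"
  let ?v = "const_vec n 1"
  have "?v $ 0 \<noteq> 0\<^sub>v n $ 0" using assms by simp
  hence "?v \<noteq> 0\<^sub>v n" by metis
  moreover have "?v \<in> carrier_vec n" by simp
  moreover from this have "?G *\<^sub>v ?v = (real n)\<^sup>2 \<cdot>\<^sub>v ?v"
    by (subst gram_ones_mult_vec) (auto simp: power2_eq_square)
  ultimately have "eigenvector ?G ?v ((real n)\<^sup>2)"
    by (simp add: eigenvector_def)
  thus "real n \<in> singular_values ?M"
    by (auto simp: singular_values_def eigenvalue_def)
  show "singular_values ?M \<subseteq> {0, real n}"
  proof
    fix s assume "s \<in> singular_values ?M"
    then obtain v where s: "0 \<le> s" and v: "v \<in> carrier_vec n" "v \<noteq> 0\<^sub>v n"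
      and eq: "?G *\<^sub>v v = s\<^sup>2 \<cdot>\<^sub>v v"
      by (auto simp: singular_values_def eigenvalue_def eigenvector_def)
    define S where "S = (\<Sum>i<n. v $ i)"
    have ev: "real n * S = s\<^sup>2 * v $ i" if "i < n" for i
      using arg_cong[OF eq, of "\<lambda>w. w $ i"] that v
      by (simp add: gram_ones_mult_vec S_def del: assoc_mult_mat_vec)
    \<comment> \<open>Summing the eigenvector equation over its coordinates leaves an equation in
      \<open>S\<close> alone. If \<open>S\<close> is nonzero it cancels; if \<open>S\<close> is 0, a
      nonzero coordinate of \<open>v\<close> forces \<open>s\<close> to be 0.\<close>
    have "(\<Sum>i<n. real n * S) = (\<Sum>i<n. s\<^sup>2 * v $ i)"
      using ev by (intro sum.cong) auto
    hence sum: "(real n)\<^sup>2 * S = s\<^sup>2 * S"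
      by (simp add: S_def sum_distrib_left power2_eq_square mult.assoc)
    obtain i where i: "i < n" "v $ i \<noteq> 0"
      using v by (metis carrier_vecD eq_vecI index_zero_vec)
    show "s \<in> {0, real n}"
    proof (cases "S = 0")
      case True
      thus ?thesis using ev[OF i(1)] i(2) by simp
    next
      case False
      hence "(real n)\<^sup>2 = s\<^sup>2" using sum by simp
      thus ?thesis using s by (simp add: power2_eq_iff_nonneg)
    qed
  qed
qed

lemma max_singular_value_ones:
  assumes "0 < n"
  shows "max_singular_value (outer_self (const_vec n 1)) = real n"
  unfolding max_singular_value_def
  using singular_values_ones[OF assms]
  by (intro Max_eqI) (auto intro: finite_subset)

lemma condition_number_ones:
  assumes "0 < n"
  shows "condition_number (outer_self (const_vec n 1)) = 1"
proof -
  have "singular_values (outer_self (const_vec n 1)) - {0} = {real n}"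
    using singular_values_ones[OF assms] assms by auto
  thus ?thesis using assms by (simp add: condition_number_def max_singular_value_ones)
qed

text \<open>The norm is the same for every admissible factorization: \<open>X\<close> is a single
  column, all products \<open>X $$ (j, 0) * d * X $$ (k, 0)\<close> are 1, and the column has unit
  length, which together fix \<open>d\<close> and the squares of the entries.\<close>

lemma symmetric_svd_ones_row_norm:
  assumes n: "0 < n" and svd: "is_symmetric_svd (outer_self (const_vec n 1)) X D" and i: "i < n"
  shows "euclidean_norm (row X i) = sqrt (1 / real n)"
proof -
  let ?M = "outer_self (const_vec n 1)"
  have X: "X \<in> carrier_mat n 1" and D: "D \<in> carrier_mat 1 1"
    and orth: "transpose_mat X * X = 1\<^sub>m 1" and M: "?M = X * D * transpose_mat X"
    using svd by (auto simp: is_symmetric_svd_def Let_def mat_rank_ones[OF n])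
  define d where "d = D $$ (0, 0)"
  have prod: "X $$ (j, 0) * d * X $$ (k, 0) = 1" if "j < n" "k < n" for j k
  proof -
    have "(X * D * transpose_mat X) $$ (j, k) = X $$ (j, 0) * d * X $$ (k, 0)"
      using X D that by (simp add: scalar_prod_def d_def)
    thus ?thesis using that by (simp flip: M)
  qed
  have "(transpose_mat X * X) $$ (0, 0) = (\<Sum>j<n. (X $$ (j, 0))\<^sup>2)"
    using X by (simp add: scalar_prod_def power2_eq_square lessThan_atLeast0)
  hence "1 = (\<Sum>j<n. (X $$ (j, 0))\<^sup>2)" by (simp add: orth)
  \<comment> \<open>Each of the \<open>n\<close> summands is a diagonal entry of the all-ones
    matrix, hence 1.\<close>
  hence "d = (\<Sum>j<n. d * (X $$ (j, 0))\<^sup>2)" by (simp flip: sum_distrib_left)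
  also have "\<dots> = (\<Sum>j<n. 1)"
    using prod by (intro sum.cong) (auto simp: power2_eq_square algebra_simps)
  finally have "d = real n" by simp
  hence "(X $$ (i, 0))\<^sup>2 = 1 / real n"
    using prod[OF i i] n by (simp add: power2_eq_square field_simps)
  thus ?thesis
    using X i by (simp add: euclidean_norm_def scalar_prod_def power2_eq_square)
qed

text \<open>Ensures that the set whose infimum defines \<open>incoherence\<close> is not
  empty.\<close>

lemma symmetric_svd_ones_exists:
  assumes n: "0 < n"
  shows "is_symmetric_svd (outer_self (const_vec n 1))
    (mat n 1 (\<lambda>_. 1 / sqrt (real n))) (mat 1 1 (\<lambda>_. real n))"
  unfolding is_symmetric_svd_def Let_def outer_self_ones_dim mat_rank_ones[OF n]
  using n by (auto simp: diagonal_mat_def scalar_prod_def intro!: eq_matI)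

text \<open>As the row norms do not depend on the factorization, the row bound becomes a condition
  on \<mu> alone, and the admissible values form the ray starting at 1.\<close>

lemma incoherence_ones:
  assumes n: "0 < n"
  shows "incoherence (outer_self (const_vec n 1)) = 1"
proof -
  let ?M = "outer_self (const_vec n 1)"
  have "(0 \<le> \<mu> \<and> (\<exists>X D. is_symmetric_svd ?M X D \<and>
      (\<forall>i<n. euclidean_norm (row X i) \<le> sqrt (\<mu> / real n)))) \<longleftrightarrow> 1 \<le> \<mu>" for \<mu>
  proof -
    have "(\<exists>X D. is_symmetric_svd ?M X D \<and>
        (\<forall>i<n. euclidean_norm (row X i) \<le> sqrt (\<mu> / real n))) \<longleftrightarrow>
      (\<exists>X D. is_symmetric_svd ?M X D \<and> (\<forall>i<n. sqrt (1 / real n) \<le> sqrt (\<mu> / real n)))"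
      using symmetric_svd_ones_row_norm[OF n] by (intro ex_cong1 conj_cong) auto
    also have "\<dots> \<longleftrightarrow> 1 / real n \<le> \<mu> / real n"
      using symmetric_svd_ones_exists[OF n] n by (auto simp only: real_sqrt_le_iff)
    also have "\<dots> \<longleftrightarrow> 1 \<le> \<mu>" using n by (simp add: divide_le_cancel)
    finally show ?thesis by auto
  qed
  hence "{\<mu>. 0 \<le> \<mu> \<and> (\<exists>X D. is_symmetric_svd ?M X D \<and>
      (\<forall>i<n. euclidean_norm (row X i) \<le> sqrt (\<mu> / real n)))} = {1..}" by auto
  thus ?thesis
    unfolding incoherence_def mat_rank_ones[OF n] outer_self_ones_dim of_nat_1 mult_1_right
    by (simp only: cInf_atLeast)
qed

section \<open>Local minimality\<close>

text \<open>The coordinate bounds pass to the means and separate them by at least the square root of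
  2, which is the hypothesis of \<open>two_block_quartic_min\<close>. That lemma compares
  \<open>u\<close> with the vector of means, and the second moments compare the means with
  \<open>x\<close>.\<close>

lemma weighted_norm_sq_two_blocks_min:
  fixes x :: "real vec" and \<beta> \<gamma> :: real
  assumes \<gamma>: "\<gamma> = (1 + \<beta>\<^sup>2) / (1 - \<beta>\<^sup>2)" and \<beta>: "1/2 < \<beta>\<^sup>2" "\<beta>\<^sup>2 < 1"
    and x: "x \<in> carrier_vec (m + m)"
    and lower: "\<And>i. i < m \<Longrightarrow> sqrt (1/2) \<le> x $ i"
    and upper: "\<And>i. i < m \<Longrightarrow> x $ (m + i) \<le> - sqrt (1/2)"
  defines "W \<equiv> four_block_mat (\<gamma> \<cdot>\<^sub>m all_ones_mat m) (all_ones_mat m) (all_ones_mat m) (\<gamma> \<cdot>\<^sub>m all_ones_mat m)"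
    and "M \<equiv> outer_self (const_vec (m + m) 1)"
  shows "weighted_norm_sq W (outer_self (const_vec m \<beta> @\<^sub>v const_vec m (- \<beta>)) - M)
    \<le> weighted_norm_sq W (outer_self x - M)"
proof (cases "m = 0")
  case True
  thus ?thesis using x by (simp add: weighted_norm_sq_def M_def)
next
  case False
  define u where "u = const_vec m \<beta> @\<^sub>v const_vec m (- \<beta>)"
  define s where "s = (\<Sum>i<m. x $ i) / m"
  define t where "t = (\<Sum>i<m. x $ (m + i)) / m"
  define p where "p = (\<Sum>i<m. (x $ i)\<^sup>2)"
  define q where "q = (\<Sum>i<m. (x $ (m + i))\<^sup>2)"
  have sums: "(\<Sum>i<m. x $ i) = m * s" "(\<Sum>i<m. x $ (m + i)) = m * t"
    using False by (simp_all add: s_def t_def)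
  have p: "m * s\<^sup>2 \<le> p" and q: "m * t\<^sup>2 \<le> q"
    unfolding p_def q_def by (intro sum_squares_ge_mean sums)+
  \<comment> \<open>The second moments enter the weighted norm only through these three products,
    with positive weights, so each product may be replaced by its lower bound.\<close>
  have "0 \<le> p" "0 \<le> q" by (simp_all add: p_def q_def sum_nonneg)
  hence pp: "(m * s\<^sup>2) * (m * s\<^sup>2) \<le> p * p" and qq: "(m * t\<^sup>2) * (m * t\<^sup>2) \<le> q * q"
    and pq: "(m * s\<^sup>2) * (m * t\<^sup>2) \<le> p * q"
    using p q by (intro mult_mono; simp)+
  have \<gamma>0: "0 < \<gamma>" using \<beta> by (simp add: \<gamma> add_pos_nonneg)
  have "m * sqrt (1/2) \<le> m * s"
    using sum_mono[of "{..<m}" "\<lambda>_. sqrt (1/2)" "\<lambda>i. x $ i"] lower by (simp flip: sums)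
  moreover have "m * t \<le> m * (- sqrt (1/2))"
    using sum_mono[of "{..<m}" "\<lambda>i. x $ (m + i)" "\<lambda>_. - sqrt (1/2)"] upper by (simp flip: sums)
  ultimately have "sqrt (1/2) \<le> s" "t \<le> - sqrt (1/2)"
    using False by (simp_all only: mult_le_cancel_left_pos of_nat_0_less_iff neq0_conv)
  hence "2 * sqrt (1/2) \<le> s - t" by simp
  hence "(2 * sqrt (1/2))\<^sup>2 \<le> (s - t)\<^sup>2" by (intro power_mono) auto
  hence st: "2 \<le> (s - t)\<^sup>2" by (simp add: power_mult_distrib real_sqrt_divide power_divide)
  have u: "u \<in> carrier_vec (m + m)" by (simp add: u_def)
  have ui: "u $ i = \<beta>" "u $ (m + i) = - \<beta>" if "i < m" for i
    using that by (simp_all add: u_def)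
  have "weighted_norm_sq W (outer_self u - M) = (real m)\<^sup>2 * (2 * \<gamma> * (\<beta>\<^sup>2 - 1)\<^sup>2 + 2 * (\<beta>\<^sup>2 + 1)\<^sup>2)"
    unfolding W_def M_def weighted_norm_sq_two_blocks[OF u]
    by (simp add: ui) (simp add: power2_eq_square algebra_simps)
  \<comment> \<open>The right side is the weighted norm at the vector whose halves are constantly
    \<open>s\<close> and \<open>t\<close>.\<close>
  also have "\<dots> \<le> (real m)\<^sup>2 * (\<gamma> * (s\<^sup>2 - 1)\<^sup>2 + \<gamma> * (t\<^sup>2 - 1)\<^sup>2 + 2 * (s * t - 1)\<^sup>2)"
    using two_block_quartic_min[OF \<gamma> \<beta> st] by (intro mult_left_mono) auto
  also have "\<dots> = \<gamma> * ((m * s\<^sup>2) * (m * s\<^sup>2) - 2 * (m * s) * (m * s) + real m * real m)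
      + \<gamma> * ((m * t\<^sup>2) * (m * t\<^sup>2) - 2 * (m * t) * (m * t) + real m * real m)
      + 2 * ((m * s\<^sup>2) * (m * t\<^sup>2) - 2 * (m * s) * (m * t) + real m * real m)"
    by (simp add: power2_eq_square algebra_simps)
  also have "\<dots> \<le> \<gamma> * (p * p - 2 * (m * s) * (m * s) + real m * real m)
      + \<gamma> * (q * q - 2 * (m * t) * (m * t) + real m * real m)
      + 2 * (p * q - 2 * (m * s) * (m * t) + real m * real m)"
    using \<gamma>0 by (intro add_mono mult_left_mono diff_right_mono order_refl pp qq pq) simp_all
  also have "\<dots> = weighted_norm_sq W (outer_self x - M)"
    unfolding W_def M_def weighted_norm_sq_two_blocks[OF x] sum_sum_product_minus_one_squared
    by (simp add: sums p_def q_def)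
  finally show ?thesis by (simp add: u_def)
qed

lemma objective_two_blocks_local_min:
  fixes \<alpha> \<beta> \<gamma> reg :: real and m :: nat
  assumes \<gamma>: "\<gamma> = (1 + \<beta>\<^sup>2) / (1 - \<beta>\<^sup>2)" and \<beta>: "sqrt (1/2) < \<beta>" "\<beta> < 1"
    and \<alpha>: "\<beta> \<le> \<alpha>" and reg: "0 \<le> reg"
  defines "W \<equiv> four_block_mat (\<gamma> \<cdot>\<^sub>m all_ones_mat m) (all_ones_mat m) (all_ones_mat m) (\<gamma> \<cdot>\<^sub>m all_ones_mat m)"
    and "u \<equiv> const_vec m \<beta> @\<^sub>v const_vec m (- \<beta>)"
  shows "is_local_min (m + m) (objective W (outer_self (const_vec (m + m) 1)) reg \<alpha>) u"
  unfolding is_local_min_def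
proof (intro conjI exI[of _ "\<beta> - sqrt (1/2)"] ballI impI)
  show u: "u \<in> carrier_vec (m + m)" by (simp add: u_def)
  \<comment> \<open>This radius is the distance from the absolute value of each coordinate of
    \<open>u\<close> to \<open>sqrt (1/2)\<close>, so inside the ball no coordinate crosses that
    threshold.\<close>
  show "0 < \<beta> - sqrt (1/2)" using \<beta> by simp
  fix x assume x: "x \<in> carrier_vec (m + m)" and close: "euclidean_norm (x - u) < \<beta> - sqrt (1/2)"
  have \<beta>0: "0 < \<beta>" using \<beta>(1) by (rule less_trans[rotated]) simp
  have "(sqrt (1/2))\<^sup>2 < \<beta>\<^sup>2" using \<beta> by (intro power_strict_mono) auto
  hence \<beta>2: "1/2 < \<beta>\<^sup>2" by (simp add: real_sqrt_divide power_divide)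
  have \<beta>2': "\<beta>\<^sup>2 < 1" using \<beta>0 \<beta>(2) by (simp add: power_less_one_iff)
  have dist: "\<bar>x $ i - u $ i\<bar> < \<beta> - sqrt (1/2)" if "i < m + m" for i
    using abs_index_le_euclidean_norm[of i "x - u"] close that x u by simp
  have lower: "sqrt (1/2) \<le> x $ i" if "i < m" for i
    using dist[of i] that by (simp add: u_def abs_less_iff)
  have upper: "x $ (m + i) \<le> - sqrt (1/2)" if "i < m" for i
    using dist[of "m + i"] that by (simp add: u_def abs_less_iff)
  \<comment> \<open>All coordinates of \<open>u\<close> have absolute value \<beta>, at most
    \<alpha>; elsewhere the regularizer can only increase the objective.\<close>
  have "(\<Sum>i<dim_vec u. (max (\<bar>u $ i\<bar> - \<alpha>) 0) ^ 4) = 0"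
    using \<beta>0 \<alpha> by (intro sum.neutral) (auto simp: u_def)
  moreover have "0 \<le> reg * (\<Sum>i<dim_vec x. (max (\<bar>x $ i\<bar> - \<alpha>) 0) ^ 4)"
    using reg by (intro mult_nonneg_nonneg sum_nonneg) auto
  ultimately show "objective W (outer_self (const_vec (m + m) 1)) reg \<alpha> u
      \<le> objective W (outer_self (const_vec (m + m) 1)) reg \<alpha> x"
    using weighted_norm_sq_two_blocks_min[OF \<gamma> \<beta>2 \<beta>2' x lower upper]
    by (simp add: objective_def W_def u_def)
qed

theorem lemmaA1:
  shows "\<exists>C0>0. \<forall>C\<ge>C0. \<forall>(n::nat) (\<beta>::real). 0 < n \<longrightarrow> even n \<longrightarrow>
    2 powr (-1/4) < \<beta> \<longrightarrow> \<beta> \<le> 9/10 \<longrightarrow>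
    (let \<gamma> = (1 + \<beta>\<^sup>2) / (1 - \<beta>\<^sup>2);
         M = outer_self (const_vec n 1);
         u = const_vec (n div 2) \<beta> @\<^sub>v const_vec (n div 2) (- \<beta>);
         J = all_ones_mat (n div 2);
         W = four_block_mat (\<gamma> \<cdot>\<^sub>m J) J J (\<gamma> \<cdot>\<^sub>m J);
         r = real (mat_rank M);
         \<sigma>1 = max_singular_value M;
         \<kappa> = condition_number M;
         \<mu> = incoherence M;
         \<alpha> = sqrt (C * \<mu> * r * \<sigma>1 / real n);
         reg = C\<^sup>2 * real n / (\<mu> * r * \<kappa>)
     in is_local_min n (objective W M reg \<alpha>) u)"
proof (intro exI[of _ 1] conjI allI impI, goal_cases)
  case (2 C n \<beta>)
  define m where "m = n div 2"
  have nm: "n = m + m" using \<open>even n\<close> by (auto simp: m_def)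
  have "sqrt (1/2) = 2 powr (-1/2)"
    by (simp add: powr_minus powr_half_sqrt real_sqrt_divide field_simps)
  also have "\<dots> < 2 powr (-1/4)" by simp
  finally have "sqrt (1/2) < \<beta>" using 2 by simp
  \<comment> \<open>Here the choice 1 for \<open>C0\<close> enters: \<open>sqrt C\<close> is the
    value of \<alpha>, and it has to be at least \<beta>.\<close>
  moreover have "\<beta> \<le> sqrt C"
  proof -
    have "\<beta> \<le> 1" using 2 by simp
    also have "1 \<le> sqrt C" using 2 by simp
    finally show ?thesis .
  qed
  ultimately have "is_local_min (m + m) (objective
      (four_block_mat (((1 + \<beta>\<^sup>2) / (1 - \<beta>\<^sup>2)) \<cdot>\<^sub>m all_ones_mat m) (all_ones_mat m) (all_ones_mat m)
        (((1 + \<beta>\<^sup>2) / (1 - \<beta>\<^sup>2)) \<cdot>\<^sub>m all_ones_mat m))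
      (outer_self (const_vec (m + m) 1)) (C\<^sup>2 * real n) (sqrt C))
      (const_vec m \<beta> @\<^sub>v const_vec m (- \<beta>))"
    using 2 by (intro objective_two_blocks_local_min) auto
  \<comment> \<open>With rank, condition number and incoherence equal to 1 and largest singular
    value \<open>n\<close>, the parameters become \<open>sqrt C\<close> and
    \<open>C\<^sup>2 * real n\<close>.\<close>
  thus ?case
    using \<open>0 < n\<close>
    by (simp add: Let_def mat_rank_ones max_singular_value_ones condition_number_ones
        incoherence_ones flip: m_def nm)
qed simp

end
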